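(* Let $d\ge 2$ and $n\ge 1$ be integers, and let $\mu_1,\ldots,\mu_{(d-1)n}$ be $(d-1)n$ mass assignments on $G_{d-1}(\mathbb{R}^d)^n$. Then there exists $p=(h_1,\ldots,h_n)\in G_{d-1}(\mathbb{R}^d)^n$ such that for every $i\in\{1,\ldots,n\}$, the hyperplane $h_i$ simultaneously bisects $\mu_{(d-1)(i-1)+1}^p,\ldots,\mu_{(d-1)i}^p$, i.e. for each of these $d-1$ mass distributions the two halfspaces of $\mathbb{R}^d$ bounded by $h_i$ have equal mass.
   Context: A ($d$-dimensional) mass distribution $\mu$ on $\mathbb{R}^d$ is a measure on $\mathbb{R}^d$ such that all open subsets of $\mathbb{R}^d$ are measurable, $0<\mu(\mathbb{R}^d)<\infty$, and $\mu(S)=0$ for every lower-dimensional subset $S$ of $\mathbb{R}^d$ (in particular for every affine hyperplane). $G_{d-1}(\mathbb{R}^d)$ is the Grassmann manifold of all $(d-1)$-dimensional linear subspaces of $\mathbb{R}^d$ (hyperplanes containing the origin), and $G_{d-1}(\mathbb{R}^d)^n$ is its $n$-fold Cartesian product, the space of $n$-tuples $p=(h_1,\ldots,h_n)$ of such hyperplanes. A mass assignment $\mu$ on $G_{d-1}(\mathbb{R}^d)^n$ is a continuous map $G_{d-1}(\mathbb{R}^d)^n\to M_d$, where $M_d$ is the space of all $d$-dimensional mass distributions on $\mathbb{R}^d$, with the weak topology (so $p\mapsto\int f\,d\mu(p)$ is continuous for every bounded continuous $f:\mathbb{R}^d\to\mathbb{R}$). We write $\mu^p:=\mu(p)$. 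*)

theory Defs
  imports "HOL-Analysis.Analysis"
begin

text \<open>\<open>\<real>\<^sup>d\<close> is \<open>real ^ 'd\<close> with \<open>d = CARD('d)\<close>.\<close>

definition grassmannian :: "nat \<Rightarrow> (real ^ 'd) set set" where
  "grassmannian k = {V. subspace V \<and> dim V = k}"

text \<open>The standard topology of the Grassmann manifold, obtained by identifying a subspace \<open>V\<close> with
  the matrix of the orthogonal projection onto \<open>V\<close>; for a subspace \<open>V\<close> this projection is
  \<^term>\<open>closest_point V\<close>.\<close>

definition grassmannian_topology :: "nat \<Rightarrow> (real ^ 'd) set topology" where
  "grassmannian_topology k =
     pullback_topology (grassmannian k) (\<lambda>V. matrix (closest_point V)) euclidean"

lemma topspace_grassmannian_topology [simp]:
  "topspace (grassmannian_topology k) = grassmannian k"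
  by (simp add: grassmannian_topology_def topspace_pullback_topology)

text \<open>The sigma-algebra may be larger than the Borel one. A set counts as lower-dimensional if it
  lies in an affine hyperplane, i.e. has affine dimension less than \<open>d\<close>; under any wider notion of
  lower-dimensional set the condition would only become more restrictive.\<close>

definition mass_distribution :: "(real ^ 'd) measure \<Rightarrow> bool" where
  "mass_distribution M \<longleftrightarrow>
     space M = UNIV \<and> (\<forall>U. open U \<longrightarrow> U \<in> sets M) \<and>
     0 < emeasure M UNIV \<and> emeasure M UNIV < \<infinity> \<and>
     (\<forall>S\<in>sets M. aff_dim S < int CARD('d) \<longrightarrow> emeasure M S = 0)"

text \<open>The weak topology on the set of mass distributions: the coarsest one making
  \<open>M \<mapsto> \<integral> f dM\<close> continuous for all bounded continuous \<open>f\<close>.\<close>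

definition weak_topology :: "(real ^ 'd) measure topology" where
  "weak_topology = topology_generated_by
     {{M. mass_distribution M \<and> integral\<^sup>L M f \<in> U} | (f :: real ^ 'd \<Rightarrow> real) U.
        continuous_on UNIV f \<and> bounded (range f) \<and> open U}"

lemma topspace_weak_topology [simp]: "topspace weak_topology = {M. mass_distribution M}"
proof -
  have "\<exists>X. (\<exists>(f :: real ^ 'd \<Rightarrow> real) U.
          X = {M. mass_distribution M \<and> integral\<^sup>L M f \<in> U} \<and>
          continuous_on UNIV f \<and> bounded (range f) \<and> open U) \<and> M \<in> X"
    if "mass_distribution M" for M :: "(real ^ 'd) measure"
    by (rule exI[of _ "{M. mass_distribution M \<and> integral\<^sup>L M (\<lambda>_. 0 :: real) \<in> UNIV}"])
       (use that in \<open>auto intro!: exI[of _ "\<lambda>_. 0 :: real"] exI[of _ "UNIV :: real set"]\<close>)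
  then show ?thesis
    unfolding weak_topology_def topology_generated_by_topspace by blast
qed

lemma continuous_map_weak_topology_iff:
  fixes \<mu> :: "'b \<Rightarrow> (real ^ 'd) measure"
  shows "continuous_map X weak_topology \<mu> \<longleftrightarrow>
    (\<forall>p\<in>topspace X. mass_distribution (\<mu> p)) \<and>
    (\<forall>f :: real ^ 'd \<Rightarrow> real. continuous_on UNIV f \<longrightarrow> bounded (range f) \<longrightarrow>
       continuous_map X euclideanreal (\<lambda>p. integral\<^sup>L (\<mu> p) f))"
  (is "?L \<longleftrightarrow> ?R")
proof
  assume L: ?L
  have mem: "mass_distribution (\<mu> p)" if "p \<in> topspace X" for p
    using continuous_map_image_subset_topspace[OF L] that by auto
  moreover have "continuous_map X euclideanreal (\<lambda>p. integral\<^sup>L (\<mu> p) f)"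
    if f: "continuous_on UNIV f" "bounded (range f)" for f :: "real ^ 'd \<Rightarrow> real"
    unfolding continuous_map
  proof (intro conjI allI impI)
    fix U :: "real set" assume "openin euclideanreal U"
    then have "openin weak_topology {M. mass_distribution M \<and> integral\<^sup>L M f \<in> U}"
      unfolding weak_topology_def using f by (intro topology_generated_by_Basis) auto
    then have "openin X {p \<in> topspace X. \<mu> p \<in> {M. mass_distribution M \<and> integral\<^sup>L M f \<in> U}}"
      by (rule openin_continuous_map_preimage[OF L])
    moreover have "{p \<in> topspace X. \<mu> p \<in> {M. mass_distribution M \<and> integral\<^sup>L M f \<in> U}} =
        {p \<in> topspace X. integral\<^sup>L (\<mu> p) f \<in> U}"
      using mem by auto
    ultimately show "openin X {p \<in> topspace X. integral\<^sup>L (\<mu> p) f \<in> U}" by simp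
  qed auto
  ultimately show ?R by blast
next
  assume R: ?R
  show ?L
    unfolding weak_topology_def
  proof (rule continuous_on_generated_topo)
    fix S assume "S \<in> {{M. mass_distribution M \<and> integral\<^sup>L M f \<in> U} | (f :: real ^ 'd \<Rightarrow> real) U.
        continuous_on UNIV f \<and> bounded (range f) \<and> open U}"
    then obtain f :: "real ^ 'd \<Rightarrow> real" and U
      where S: "S = {M. mass_distribution M \<and> integral\<^sup>L M f \<in> U}"
        and f: "continuous_on UNIV f" "bounded (range f)" and U: "open U"
      by blast
    have "openin X {p \<in> topspace X. integral\<^sup>L (\<mu> p) f \<in> U}"
      using R f U by (intro openin_continuous_map_preimage[where Y = euclideanreal]) auto
    moreover have "\<mu> -` S \<inter> topspace X = {p \<in> topspace X. integral\<^sup>L (\<mu> p) f \<in> U}"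
      using R S by auto
    ultimately show "openin X (\<mu> -` S \<inter> topspace X)" by simp
  next
    have "\<mu> ` topspace X \<subseteq> topspace weak_topology" using R by auto
    then show "\<mu> ` topspace X \<subseteq> \<Union> {{M. mass_distribution M \<and> integral\<^sup>L M f \<in> U} | (f :: real ^ 'd \<Rightarrow> real) U.
        continuous_on UNIV f \<and> bounded (range f) \<and> open U}"
      unfolding weak_topology_def topology_generated_by_topspace .
  qed
qed

text \<open>Tuples \<open>(h\<^sub>1, \<dots>, h\<^sub>n)\<close> of linear hyperplanes are extensional functions on \<open>{1..n}\<close>.\<close>

definition mass_assignment ::
    "nat \<Rightarrow> ((nat \<Rightarrow> (real ^ 'd) set) \<Rightarrow> (real ^ 'd) measure) \<Rightarrow> bool" where
  "mass_assignment n \<mu> \<longleftrightarrow>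
     continuous_map (product_topology (\<lambda>_. grassmannian_topology (CARD('d) - 1)) {1..n})
       weak_topology \<mu>"

definition bisects :: "(real ^ 'd) set \<Rightarrow> (real ^ 'd) measure \<Rightarrow> bool" where
  "bisects h M \<longleftrightarrow>
     (\<exists>a. a \<noteq> 0 \<and> h = {x. a \<bullet> x = 0} \<and>
          emeasure M {x. a \<bullet> x \<le> 0} = emeasure M {x. a \<bullet> x \<ge> 0})"

end

theory Submission
  imports Defs "HOL-Library.Z2"
begin

text \<open>
  A hyperplane is encoded by a normal vector, and the normal vector by a point of the cube
  \<open>[-1,1]\<^sup>m\<close> with \<open>m = d - 1\<close> through a variant of spherical coordinates. Then an \<open>n\<close>-tuple of hyperplanes
  is a point of a cube of dimension \<open>N = mn\<close>, on which the differences of the masses of the two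
  halfspaces are \<open>N\<close> continuous functions. On a facet of the cube, flipping the sign of one
  or two coordinates either preserves all normal vectors or negates exactly one of them, and the
  \<open>m\<close> functions of that block change sign with it.

  That such functions have a common zero is a mod 2 degree statement (the top power of the first
  Stiefel-Whitney class of projective space does not vanish). On a fine triangulation, let \<open>c\<^sub>k\<close> be the
  coboundary of the sign of the \<open>k\<close>-th function. The cup product of all \<open>c\<^sub>k\<close> is nonzero only
  on a simplex along whose \<open>k\<close>-th edge the \<open>k\<close>-th function changes sign, for every \<open>k\<close>. The sum of
  this product over the cube is odd: it is a coboundary, so that Stokes' formula and the symmetry of
  the facets reduce it to the same sum on the last facet, with one function fewer. Refining the
  triangulation and using compactness gives a common zero.
\<close>

section \<open>Sign changes along chains of grid points\<close>

declare add_bit_eq_xor [simp del] mult_bit_eq_and [simp del]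

lemma bit_double [simp]: "x + x = (0::bit)"
  by (cases x) auto

text \<open>The terms for \<open>(i, j)\<close> and \<open>(j, i)\<close> cancel modulo 2.\<close>

lemma symmetric_off_diagonal_sum_bit:
  fixes h :: "'a \<Rightarrow> 'a \<Rightarrow> bit"
  assumes "finite A" "\<And>i j. i \<in> A \<Longrightarrow> j \<in> A \<Longrightarrow> i \<noteq> j \<Longrightarrow> h i j = h j i"
  shows "(\<Sum>i\<in>A. \<Sum>j\<in>A-{i}. h i j) = 0"
  using assms
proof (induction A rule: finite_induct)
  case (insert a A)
  have "(\<Sum>j\<in>insert a A-{i}. h i j) = h a i + (\<Sum>j\<in>A-{i}. h i j)" if "i \<in> A" for i
  proof -
    have "insert a A - {i} = insert a (A - {i})" using insert that by auto
    then show ?thesis using insert that by simp metis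
  qed
  then have "(\<Sum>i\<in>A. \<Sum>j\<in>insert a A-{i}. h i j) = (\<Sum>i\<in>A. h a i) + (\<Sum>i\<in>A. \<Sum>j\<in>A-{i}. h i j)"
    by (simp add: sum.distrib)
  moreover have "insert a A - {a} = A" using insert by auto
  moreover have "(\<Sum>i\<in>A. \<Sum>j\<in>A-{i}. h i j) = 0" using insert by simp
  ultimately show ?case using insert by simp
qed simp

text \<open>Two neighbouring points of the integer grid are ordered by their sets of odd coordinates. This
  order does not depend on the signs of the coordinates, so the simplices of the triangulation of
  the cube by its chains, and the cup product formed with that order, are preserved by all flips;
  the usual monotone lattice order is reversed by them. Faces of the cube lie at the even
  number \<open>p\<close>.\<close>

definition flip :: "nat set \<Rightarrow> (nat \<Rightarrow> 'a::uminus) \<Rightarrow> nat \<Rightarrow> 'a" where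
  "flip F x = (\<lambda>k. if k \<in> F then - x k else x k)"

definition odds :: "(nat \<Rightarrow> int) \<Rightarrow> nat set" where
  "odds v = {i. odd (v i)}"

text \<open>Coordinates from \<open>r\<close> on are frozen at \<open>p\<close> instead of being
  dropped; for \<open>p \<ge> 0\<close> this makes \<open>grid p r\<close> a facet of
  \<open>grid p (Suc r)\<close>.\<close>

definition grid :: "int \<Rightarrow> nat \<Rightarrow> (nat \<Rightarrow> int) set" where
  "grid p r = {v. (\<forall>i<r. \<bar>v i\<bar> \<le> p) \<and> (\<forall>i\<ge>r. v i = p)}"

text \<open>For even \<open>p\<close> these are the top vertices of the simplices of full dimension
  \<open>r\<close>, since every step up in a saturated chain makes one more coordinate odd.\<close>

definition odd_grid :: "int \<Rightarrow> nat \<Rightarrow> (nat \<Rightarrow> int) set" where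
  "odd_grid p r = {v \<in> grid p r. \<forall>i<r. odd (v i)}"

text \<open>A grid point stands for the cube of side 2 with even corners centred there, extended in
  its odd directions. This is the mod 2 cellular coboundary: the sum of a cochain over the facets of
  that cube.\<close>

definition codiff :: "((nat \<Rightarrow> int) \<Rightarrow> bit) \<Rightarrow> (nat \<Rightarrow> int) \<Rightarrow> bit" where
  "codiff g v = (\<Sum>i\<in>odds v. g (v(i := v i + 1)) + g (v(i := v i - 1)))"

text \<open>\<open>cup \<sigma> k v\<close> is the sum, over all saturated chains \<open>v\<^sub>0 < \<dots> < v\<^sub>k = v\<close>, of the cup product of the
  coboundaries of \<open>\<sigma> 0, \<dots>, \<sigma> (k - 1)\<close>.\<close>

primrec cup :: "(nat \<Rightarrow> (nat \<Rightarrow> int) \<Rightarrow> bit) \<Rightarrow> nat \<Rightarrow> (nat \<Rightarrow> int) \<Rightarrow> bit" where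
  "cup \<sigma> 0 v = 1"
| "cup \<sigma> (Suc k) v = codiff (\<lambda>u. cup \<sigma> k u * (\<sigma> k u + \<sigma> k v)) v"

text \<open>A face of codimension two is reached by changing its two odd coordinates in either
  order, and the two contributions cancel.\<close>

lemma codiff_codiff: "codiff (codiff g) v = 0"
proof (cases "finite (odds v)")
  case True
  define h where "h i j =
    g (v(i := v i + 1, j := v j + 1)) + g (v(i := v i + 1, j := v j - 1)) +
    g (v(i := v i - 1, j := v j + 1)) + g (v(i := v i - 1, j := v j - 1))" for i j
  have *: "codiff g (v(i := v i + 1)) + codiff g (v(i := v i - 1)) = (\<Sum>j\<in>odds v - {i}. h i j)"
    if "i \<in> odds v" for i
  proof -
    have o: "odds (v(i := v i + 1)) = odds v - {i}" "odds (v(i := v i - 1)) = odds v - {i}"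
      using that by (auto simp: odds_def)
    show ?thesis
      unfolding codiff_def o sum.distrib[symmetric]
      by (intro sum.cong) (auto simp: h_def fun_upd_apply)
  qed
  have "h i j = h j i" if "i \<noteq> j" for i j
    using that by (simp add: h_def fun_upd_twist[of i j] add_ac)
  then have "(\<Sum>i\<in>odds v. \<Sum>j\<in>odds v - {i}. h i j) = 0"
    by (intro symmetric_off_diagonal_sum_bit True) auto
  then show ?thesis
    unfolding codiff_def[of "codiff g"] using * by simp
qed (simp add: codiff_def)

lemma codiff_mult_add:
  "codiff (\<lambda>u. g u * (h u + c)) v = codiff (\<lambda>u. g u * h u) v + c * codiff g v"
  by (simp add: codiff_def sum.distrib sum_distrib_left algebra_simps)

text \<open>Inductively, \<open>cup \<sigma> (Suc k)\<close> is the coboundary of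
  \<open>cup \<sigma> k\<close> times \<open>\<sigma> k\<close>: the remaining term is
  \<open>\<sigma> k v\<close> times the coboundary of \<open>cup \<sigma> k\<close>, which vanishes.
  Coboundaries are cocycles.\<close>

lemma codiff_cup: "codiff (cup \<sigma> k) v = 0"
proof (induction k arbitrary: v)
  case 0
  show ?case by (simp add: codiff_def)
next
  case (Suc k)
  have "cup \<sigma> (Suc k) = codiff (\<lambda>u. cup \<sigma> k u * \<sigma> k u)"
    using Suc by (intro ext) (simp add: codiff_mult_add)
  then show ?case by (simp only: codiff_codiff)
qed

lemma cup_Suc: "cup \<sigma> (Suc k) v = codiff (\<lambda>u. cup \<sigma> k u * \<sigma> k u) v"
  by (simp add: codiff_mult_add codiff_cup)

section \<open>Invariance of the cup product under flips\<close>

lemma flip_flip [simp]: "flip F (flip F x) = (x :: nat \<Rightarrow> 'a::group_add)"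
  by (auto simp: flip_def)

lemma odds_flip [simp]: "odds (flip F v) = odds v"
  by (auto simp: odds_def flip_def)

lemma finite_grid: "finite (grid p r)"
proof -
  have "grid p r \<subseteq> (\<lambda>f i. if i < r then f i else p) ` ({..<r} \<rightarrow>\<^sub>E {-p..p})"
  proof
    fix v assume v: "v \<in> grid p r"
    have "v = (\<lambda>i. if i < r then restrict v {..<r} i else p)"
      using v by (auto simp: grid_def fun_eq_iff)
    moreover have "restrict v {..<r} \<in> {..<r} \<rightarrow>\<^sub>E {-p..p}"
      using v by (auto simp: grid_def abs_le_iff minus_le_iff)
    ultimately show "v \<in> (\<lambda>f i. if i < r then f i else p) ` ({..<r} \<rightarrow>\<^sub>E {-p..p})" by blast
  qed
  then show ?thesis by (rule finite_subset) (auto intro!: finite_imageI finite_PiE)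
qed

text \<open>Flips carry chains to chains, and the constants \<open>\<kappa> i\<close> cancel in the
  differences. As \<open>\<bar>v j\<bar> = p\<close> is even, coordinate \<open>j\<close> stays
  fixed along all chains ending at \<open>v\<close>, so the hypothesis applies to each of their
  points.\<close>

lemma cup_flip:
  assumes "even p"
    and "\<And>i x. i < k \<Longrightarrow> x \<in> grid p r \<Longrightarrow> \<bar>x j\<bar> = p \<Longrightarrow> \<sigma> i (flip F x) = \<sigma> i x + \<kappa> i"
    and "v \<in> grid p r" "\<bar>v j\<bar> = p"
  shows "cup \<sigma> k (flip F v) = cup \<sigma> k v"
  using assms
proof (induction k arbitrary: v)
  case (Suc k)
  have "(let f = (\<lambda>u. cup \<sigma> k u * (\<sigma> k u + \<sigma> k (flip F v))) in
          f ((flip F v)(i := flip F v i + 1)) + f ((flip F v)(i := flip F v i - 1))) =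
        (let f = (\<lambda>u. cup \<sigma> k u * (\<sigma> k u + \<sigma> k v)) in f (v(i := v i + 1)) + f (v(i := v i - 1)))"
    if i: "i \<in> odds v" for i
  proof -
    have odd: "odd (v i)" using i by (simp add: odds_def)
    have "i < r"
      using Suc.prems(1,3) odd by (cases "i < r") (auto simp: grid_def)
    then have le: "\<bar>v i\<bar> \<le> p"
      using Suc.prems(3) by (auto simp: grid_def)
    have "\<bar>v i\<bar> \<noteq> p" using Suc.prems(1) odd by (metis dvd_abs_iff)
    with le have lt: "\<bar>v i\<bar> < p" by simp
    have "i \<noteq> j" using \<open>\<bar>v i\<bar> \<noteq> p\<close> Suc.prems(4) by auto
    define a where "a = v(i := v i + 1)"
    define b where "b = v(i := v i - 1)"
    have ab: "a \<in> grid p r" "b \<in> grid p r" "\<bar>a j\<bar> = p" "\<bar>b j\<bar> = p"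
      using Suc.prems(3,4) lt \<open>i < r\<close> \<open>i \<noteq> j\<close> by (auto simp: a_def b_def grid_def)
    have f: "cup \<sigma> k (flip F u) * (\<sigma> k (flip F u) + \<sigma> k (flip F v)) = cup \<sigma> k u * (\<sigma> k u + \<sigma> k v)"
      if "u \<in> grid p r" "\<bar>u j\<bar> = p" for u
    proof -
      have "cup \<sigma> k (flip F u) = cup \<sigma> k u"
        using Suc.prems(1,2) that by (intro Suc.IH) auto
      moreover have "\<sigma> k (flip F u) + \<sigma> k (flip F v) = \<sigma> k u + \<sigma> k v + (\<kappa> k + \<kappa> k)"
        using Suc.prems that by (simp add: algebra_simps del: bit_double)
      ultimately show ?thesis by simp
    qed
    note fab = f[OF ab(1,3)] f[OF ab(2,4)]
    show ?thesis
    proof (cases "i \<in> F")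
      \<comment> \<open>Negating coordinate \<open>i\<close> only exchanges its upper and lower
        neighbour.\<close>
      case True
      then have "(flip F v)(i := flip F v i + 1) = flip F b" "(flip F v)(i := flip F v i - 1) = flip F a"
        by (auto simp: flip_def a_def b_def)
      then show ?thesis
        unfolding Let_def a_def[symmetric] b_def[symmetric] by (simp only: fab add.commute)
    next
      case False
      then have "(flip F v)(i := flip F v i + 1) = flip F a" "(flip F v)(i := flip F v i - 1) = flip F b"
        by (auto simp: flip_def a_def b_def)
      then show ?thesis
        unfolding Let_def a_def[symmetric] b_def[symmetric] by (simp only: fab)
    qed
  qed
  then show ?case
    by (auto simp: codiff_def Let_def intro!: sum.cong)
qed simp

section \<open>Stokes' formula on the grid\<close>

definition odd_facet :: "int \<Rightarrow> nat \<Rightarrow> nat \<Rightarrow> int \<Rightarrow> (nat \<Rightarrow> int) set" where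
  "odd_facet p r i s = {u \<in> grid p r. u i = s \<and> (\<forall>l<r. l \<noteq> i \<longrightarrow> odd (u l))}"

text \<open>A point whose \<open>i\<close>-th coordinate is even and strictly between the bounds
  arises from two neighbours and cancels; a point on one of the two facets arises once.\<close>

lemma sum_odd_grid_shift:
  assumes "even p" "i < r" "p > 0"
  shows "(\<Sum>v\<in>odd_grid p r. g (v(i := v i + 1)) + g (v(i := v i - 1))) =
    (\<Sum>u\<in>odd_facet p r i p. g u) + (\<Sum>u\<in>odd_facet p r i (-p). g u :: bit)"
proof -
  \<comment> \<open>The cells of codimension one orthogonal to direction \<open>i\<close>; each of
    the two shifts covers all of them except one facet.\<close>
  define E where "E = {u \<in> grid p r. even (u i) \<and> (\<forall>l<r. l \<noteq> i \<longrightarrow> odd (u l))}"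
  have finE: "finite E" using finite_grid by (simp add: E_def)
  have lt: "\<bar>v i\<bar> < p" if "v \<in> odd_grid p r" for v
  proof -
    have "\<bar>v i\<bar> \<le> p" "odd (v i)" using that assms by (auto simp: odd_grid_def grid_def)
    moreover have "\<bar>v i\<bar> \<noteq> p" using assms \<open>odd (v i)\<close> by (metis dvd_abs_iff)
    ultimately show ?thesis by simp
  qed
  have "(\<Sum>v\<in>odd_grid p r. g (v(i := v i + 1))) = sum g (E - odd_facet p r i (-p))"
  proof (rule sum.reindex_bij_witness[of _ "\<lambda>u. u(i := u i - 1)" "\<lambda>v. v(i := v i + 1)"], goal_cases)
    case (2 v)
    have "odd (v i)" using 2 assms by (simp add: odd_grid_def)
    then have "even (v i + 1)" "\<bar>v i + 1\<bar> \<le> p" "v i + 1 \<noteq> - p"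
      using lt[OF 2] assms by auto
    then show ?case using 2 assms(2)
      by (simp add: E_def odd_facet_def odd_grid_def grid_def)
  next
    case (4 u)
    then have "\<bar>u i\<bar> \<le> p" "u i \<noteq> - p" using assms by (auto simp: E_def odd_facet_def grid_def)
    moreover have "odd (u i - 1)" using 4 by (simp add: E_def)
    ultimately have "\<bar>u i - 1\<bar> \<le> p" "odd (u i - 1)" by auto
    then show ?case using 4 assms(2)
      by (simp add: E_def odd_grid_def grid_def)
  qed auto
  moreover have "(\<Sum>v\<in>odd_grid p r. g (v(i := v i - 1))) = sum g (E - odd_facet p r i p)"
  proof (rule sum.reindex_bij_witness[of _ "\<lambda>u. u(i := u i + 1)" "\<lambda>v. v(i := v i - 1)"], goal_cases)
    case (2 v)
    have "odd (v i)" using 2 assms by (simp add: odd_grid_def)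
    then have "even (v i - 1)" "\<bar>v i - 1\<bar> \<le> p" "v i - 1 \<noteq> p"
      using lt[OF 2] assms by auto
    then show ?case using 2 assms(2)
      by (simp add: E_def odd_facet_def odd_grid_def grid_def)
  next
    case (4 u)
    then have "\<bar>u i\<bar> \<le> p" "u i \<noteq> p" using assms by (auto simp: E_def odd_facet_def grid_def)
    moreover have "odd (u i + 1)" using 4 by (simp add: E_def)
    ultimately have "\<bar>u i + 1\<bar> \<le> p" "odd (u i + 1)" by auto
    then show ?case using 4 assms(2)
      by (simp add: E_def odd_grid_def grid_def)
  qed auto
  moreover have "sum g E = sum g (E - odd_facet p r i s) + sum g (odd_facet p r i s)" if "even s" for s
    using that finE by (intro sum.subset_diff) (auto simp: E_def odd_facet_def)
  from this[of p] this[of "-p"] assms have "sum g (E - odd_facet p r i (-p)) + sum g (odd_facet p r i (-p)) =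
      sum g (E - odd_facet p r i p) + sum g (odd_facet p r i p)"
    by (metis dvd_minus_iff)
  ultimately show ?thesis
    unfolding sum.distrib
    by (cases "sum g (E - odd_facet p r i (-p))"; cases "sum g (odd_facet p r i (-p))";
        cases "sum g (E - odd_facet p r i p)"; cases "sum g (odd_facet p r i p)") auto
qed

text \<open>Stokes: the top-dimensional sum of the coboundary of \<open>cup \<sigma> r\<close> multiplied by \<open>\<sigma> r\<close> reduces to the facets, and opposite
  facets cancel except for the last pair, on which \<open>\<sigma> r\<close> changes by one.\<close>

lemma sum_cup_odd_grid_Suc:
  assumes "even p" "p > 0"
    and sym: "\<And>j. j \<le> r \<Longrightarrow> \<exists>F \<kappa>. j \<in> F \<and> F \<subseteq> {j..r} \<and> \<kappa> r = (if j = r then 1 else 0) \<and>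
      (\<forall>x\<in>grid p (Suc r). \<bar>x j\<bar> = p \<longrightarrow> (\<forall>i\<le>r. \<sigma> i (flip F x) = \<sigma> i x + \<kappa> i))"
  shows "(\<Sum>v\<in>odd_grid p (Suc r). cup \<sigma> (Suc r) v) = (\<Sum>v\<in>odd_grid p r. cup \<sigma> r v)"
proof -
  define g where "g u = cup \<sigma> r u * \<sigma> r u" for u
  have facet: "(\<Sum>u\<in>odd_facet p (Suc r) j p. g u) + (\<Sum>u\<in>odd_facet p (Suc r) j (-p). g u) =
      (if j = r then \<Sum>v\<in>odd_grid p r. cup \<sigma> r v else 0)" if j: "j \<le> r" for j
  proof -
    obtain F \<kappa> where F: "j \<in> F" "F \<subseteq> {j..r}" "\<kappa> r = (if j = r then 1 else 0)"
      and eq: "\<And>x i. x \<in> grid p (Suc r) \<Longrightarrow> \<bar>x j\<bar> = p \<Longrightarrow> i \<le> r \<Longrightarrow> \<sigma> i (flip F x) = \<sigma> i x + \<kappa> i"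
      using sym[OF j] by blast
    have F': "i < Suc r" if "i \<in> F" for i using F(2) that by auto
    have gflip: "flip F u \<in> grid p (Suc r)" if "u \<in> grid p (Suc r)" for u
      using that by (auto simp: grid_def flip_def dest: F')
    \<comment> \<open>As \<open>j \<in> F\<close>, the flip exchanges the two opposite
      facets.\<close>
    have "(\<Sum>u\<in>odd_facet p (Suc r) j (-p). g u) = (\<Sum>u\<in>odd_facet p (Suc r) j p. g (flip F u))"
    proof (rule sum.reindex_bij_witness[of _ "flip F" "flip F"], goal_cases)
      case (2 u)
      then show ?case using F(1) gflip[of u] by (auto simp: odd_facet_def) (auto simp: flip_def split: if_splits)
    next
      case (4 u)
      then show ?case using F(1) gflip[of u] by (auto simp: odd_facet_def) (auto simp: flip_def split: if_splits)
    qed auto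
    then have "(\<Sum>u\<in>odd_facet p (Suc r) j p. g u) + (\<Sum>u\<in>odd_facet p (Suc r) j (-p). g u) =
        (\<Sum>u\<in>odd_facet p (Suc r) j p. g u + g (flip F u))"
      by (simp add: sum.distrib)
    also have "\<dots> = (\<Sum>u\<in>odd_facet p (Suc r) j p. cup \<sigma> r u * \<kappa> r)"
    proof (rule sum.cong[OF refl])
      fix u assume u: "u \<in> odd_facet p (Suc r) j p"
      then have u': "u \<in> grid p (Suc r)" "\<bar>u j\<bar> = p" using \<open>p > 0\<close> by (auto simp: odd_facet_def)
      have "cup \<sigma> r (flip F u) = cup \<sigma> r u"
        by (rule cup_flip[OF \<open>even p\<close> _ u']) (rule eq; simp)
      moreover have "\<sigma> r (flip F u) = \<sigma> r u + \<kappa> r" by (rule eq[OF u']) simp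
      ultimately have "g u + g (flip F u) = cup \<sigma> r u * \<kappa> r + (cup \<sigma> r u * \<sigma> r u + cup \<sigma> r u * \<sigma> r u)"
        by (simp add: g_def algebra_simps del: bit_double)
      then show "g u + g (flip F u) = cup \<sigma> r u * \<kappa> r" by simp
    qed
    also have "\<dots> = (if j = r then \<Sum>v\<in>odd_grid p r. cup \<sigma> r v else 0)"
    proof (cases "j = r")
      case True
      \<comment> \<open>Freezing coordinate \<open>r\<close> at \<open>p\<close> gives the grid of
        one dimension less.\<close>
      have "odd_facet p (Suc r) r p = odd_grid p r"
        using \<open>p > 0\<close> by (auto simp: odd_facet_def odd_grid_def grid_def less_Suc_eq)
          (metis Suc_leI le_neq_implies_less)
      then show ?thesis using True F(3) by simp
    qed (use F(3) in simp)
    finally show ?thesis .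
  qed
  have odds: "odds v = {..<Suc r}" if "v \<in> odd_grid p (Suc r)" for v
    using that \<open>even p\<close> by (auto simp: odds_def odd_grid_def grid_def not_less) (metis not_less)
  have "(\<Sum>v\<in>odd_grid p (Suc r). cup \<sigma> (Suc r) v) =
      (\<Sum>v\<in>odd_grid p (Suc r). \<Sum>j<Suc r. g (v(j := v j + 1)) + g (v(j := v j - 1)))"
    unfolding cup_Suc codiff_def g_def by (intro sum.cong refl) (simp only: odds)
  also have "\<dots> = (\<Sum>j<Suc r. \<Sum>v\<in>odd_grid p (Suc r). g (v(j := v j + 1)) + g (v(j := v j - 1)))"
    by (rule sum.swap)
  also have "\<dots> = (\<Sum>j<Suc r. if j = r then \<Sum>v\<in>odd_grid p r. cup \<sigma> r v else 0)"
    using assms(1,2) by (intro sum.cong refl) (simp only: sum_odd_grid_shift facet lessThan_iff less_Suc_eq_le)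
  also have "\<dots> = (\<Sum>v\<in>odd_grid p r. cup \<sigma> r v)"
    by simp
  finally show ?thesis .
qed

text \<open>A nonzero sum has a nonzero summand, which unrolls the recursion of \<open>cup\<close>
  into a chain. Each step down makes an odd coordinate even, after which it stays fixed; so no
  coordinate moves by more than one along the whole chain.\<close>

lemma chain_if_cup_nonzero:
  assumes "cup \<sigma> k v \<noteq> 0"
  shows "\<exists>w. w k = v \<and> (\<forall>l<k. \<sigma> l (w l) \<noteq> \<sigma> l (w (Suc l))) \<and>
    (\<forall>l\<le>k. \<forall>i. w l i = v i \<or> odd (v i) \<and> \<bar>w l i - v i\<bar> = 1)"
  using assms
proof (induction k arbitrary: v)
  case 0
  then show ?case by (intro exI[of _ "\<lambda>_. v"]) auto
next
  case (Suc k)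
  then have "codiff (\<lambda>u. cup \<sigma> k u * (\<sigma> k u + \<sigma> k v)) v \<noteq> 0" by simp
  then obtain i where i: "i \<in> odds v" and
    "cup \<sigma> k (v(i := v i + 1)) * (\<sigma> k (v(i := v i + 1)) + \<sigma> k v) +
     cup \<sigma> k (v(i := v i - 1)) * (\<sigma> k (v(i := v i - 1)) + \<sigma> k v) \<noteq> 0"
    unfolding codiff_def by (meson sum.neutral)
  then obtain s where s: "s = 1 \<or> s = - 1"
    and "cup \<sigma> k (v(i := v i + s)) * (\<sigma> k (v(i := v i + s)) + \<sigma> k v) \<noteq> 0"
    by (metis add_0 add_uminus_conv_diff)
  then have u: "cup \<sigma> k (v(i := v i + s)) \<noteq> 0" "\<sigma> k (v(i := v i + s)) \<noteq> \<sigma> k v"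
    by auto
  from Suc.IH[OF u(1)] obtain w where w: "w k = v(i := v i + s)"
    "\<And>l. l < k \<Longrightarrow> \<sigma> l (w l) \<noteq> \<sigma> l (w (Suc l))"
    "\<And>l j. l \<le> k \<Longrightarrow> w l j = (v(i := v i + s)) j \<or>
       odd ((v(i := v i + s)) j) \<and> \<bar>w l j - (v(i := v i + s)) j\<bar> = 1"
    by blast
  have "odd (v i)" using i by (simp add: odds_def)
  have "(w(Suc k := v)) l j = v j \<or> odd (v j) \<and> \<bar>(w(Suc k := v)) l j - v j\<bar> = 1" if "l \<le> Suc k" for l j
    using w(3)[of l j] that s \<open>odd (v i)\<close> by (cases "l = Suc k"; cases "j = i") auto
  then show ?case
    using w(1,2) u(2) by (intro exI[of _ "w(Suc k := v)"]) (auto simp: less_Suc_eq)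
qed

text \<open>The sum of the cup products is 1: for \<open>r = 0\<close> it is an empty product at a
  single point, and the symmetry carries the value from \<open>r\<close> to \<open>Suc r\<close>.
  Hence some summand is nonzero.\<close>

theorem sign_changing_chain:
  fixes \<sigma> :: "nat \<Rightarrow> (nat \<Rightarrow> int) \<Rightarrow> bit"
  assumes "even p" "p > 0"
    and sym: "\<And>r j. r < N \<Longrightarrow> j \<le> r \<Longrightarrow> \<exists>F \<kappa>. j \<in> F \<and> F \<subseteq> {j..r} \<and> \<kappa> r = (if j = r then 1 else 0) \<and>
      (\<forall>x\<in>grid p (Suc r). \<bar>x j\<bar> = p \<longrightarrow> (\<forall>i\<le>r. \<sigma> i (flip F x) = \<sigma> i x + \<kappa> i))"
  obtains w where "\<And>k. k \<le> N \<Longrightarrow> w k \<in> grid p N"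
    and "\<And>k. k < N \<Longrightarrow> \<sigma> k (w k) \<noteq> \<sigma> k (w (Suc k))"
    and "\<And>k i. k \<le> N \<Longrightarrow> \<bar>w k i - w N i\<bar> \<le> 1"
proof -
  have "r \<le> N \<Longrightarrow> (\<Sum>v\<in>odd_grid p r. cup \<sigma> r v) = 1" for r
  proof (induction r)
    case 0
    have "odd_grid p 0 = {\<lambda>_. p}" by (auto simp: odd_grid_def grid_def)
    then show ?case by simp
  next
    case (Suc r)
    then have "(\<Sum>v\<in>odd_grid p (Suc r). cup \<sigma> (Suc r) v) = (\<Sum>v\<in>odd_grid p r. cup \<sigma> r v)"
      by (intro sum_cup_odd_grid_Suc sym assms(1,2)) auto
    then show ?case using Suc by simp
  qed
  then have "(\<Sum>v\<in>odd_grid p N. cup \<sigma> N v) \<noteq> 0" by simp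
  then obtain v where v: "v \<in> odd_grid p N" "cup \<sigma> N v \<noteq> 0" by (meson sum.neutral)
  from chain_if_cup_nonzero[OF v(2)] obtain w where w: "w N = v"
    "\<And>l. l < N \<Longrightarrow> \<sigma> l (w l) \<noteq> \<sigma> l (w (Suc l))"
    "\<And>l i. l \<le> N \<Longrightarrow> w l i = v i \<or> odd (v i) \<and> \<bar>w l i - v i\<bar> = 1" by blast
  show ?thesis
  proof (rule that)
    fix k assume k: "k \<le> N"
    \<comment> \<open>An odd coordinate lies strictly between the even bounds, so a move by one
      stays in the grid.\<close>
    have "\<bar>w k i\<bar> \<le> p" if "i < N" for i
    proof -
      have "\<bar>v i\<bar> \<le> p" "odd (v i)" using v(1) that by (auto simp: odd_grid_def grid_def)
      moreover have "\<bar>v i\<bar> \<noteq> p" using \<open>even p\<close> \<open>odd (v i)\<close> by (metis dvd_abs_iff)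
      ultimately show ?thesis using w(3)[OF k, of i] by auto
    qed
    moreover have "w k i = p" if "i \<ge> N" for i
      using w(3)[OF k, of i] v(1) that \<open>even p\<close> by (auto simp: odd_grid_def grid_def)
    ultimately show "w k \<in> grid p N" by (simp add: grid_def)
  next
    fix k i assume "k \<le> N"
    with w(3)[of k i] w(1) show "\<bar>w k i - w N i\<bar> \<le> 1" by auto
  qed (use w in auto)
qed

section \<open>Common zeros on the cube\<close>

definition cube :: "nat \<Rightarrow> (nat \<Rightarrow> real) set" where
  "cube N = {x. (\<forall>i<N. \<bar>x i\<bar> \<le> 1) \<and> (\<forall>i\<ge>N. x i = 1)}"

lemma cube_mono: "r \<le> N \<Longrightarrow> cube r \<subseteq> cube N"
proof
  fix x assume "r \<le> N" and x: "x \<in> cube r"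
  have "\<bar>x i\<bar> \<le> 1" for i using x by (cases "i < r") (auto simp: cube_def)
  with x \<open>r \<le> N\<close> show "x \<in> cube N" by (auto simp: cube_def)
qed

lemma compact_cube: "compact (cube N)"
proof -
  have "cube N = PiE UNIV (\<lambda>i. if i < N then {-1..1} else {1})"
  proof (intro set_eqI)
    fix x :: "nat \<Rightarrow> real"
    have "x i \<in> (if i < N then {-1..1} else {1}) \<longleftrightarrow> (i < N \<longrightarrow> \<bar>x i\<bar> \<le> 1) \<and> (i \<ge> N \<longrightarrow> x i = 1)" for i
      by (simp add: abs_le_iff) linarith
    then show "x \<in> cube N \<longleftrightarrow> x \<in> PiE UNIV (\<lambda>i. if i < N then {-1..1} else {1})"
      unfolding cube_def PiE_UNIV_domain Pi_iff by auto
  qed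
  moreover have "compactin (product_topology (\<lambda>_. euclideanreal) UNIV)
      (PiE UNIV (\<lambda>i::nat. if i < N then {-1..1} else {1}))"
    by (auto simp: compactin_PiE)
  ultimately show ?thesis by (simp add: euclidean_product_topology)
qed

text \<open>The nowhere vanishing functions \<open>s k\<close> serve only to choose signs, compatibly with the flips, where
  \<open>f k\<close> vanishes.\<close>

theorem common_zero_of_flip_symmetric:
  fixes f s :: "nat \<Rightarrow> (nat \<Rightarrow> real) \<Rightarrow> real"
  assumes cont: "\<And>k. k < N \<Longrightarrow> continuous_on (cube N) (f k)"
    and s0: "\<And>k x. k < N \<Longrightarrow> x \<in> cube N \<Longrightarrow> s k x \<noteq> 0"
    and sym: "\<And>r j. r < N \<Longrightarrow> j \<le> r \<Longrightarrow> \<exists>F c. j \<in> F \<and> F \<subseteq> {j..r} \<and>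
      (\<forall>i\<le>r. c i = 1 \<or> c i = - 1) \<and> c r = (if j = r then - 1 else 1) \<and>
      (\<forall>x\<in>cube (Suc r). \<bar>x j\<bar> = 1 \<longrightarrow>
        (\<forall>i\<le>r. f i (flip F x) = c i * f i x \<and> s i (flip F x) = c i * s i x))"
  obtains x where "x \<in> cube N" and "\<And>k. k < N \<Longrightarrow> f k x = 0"
proof -
  define g where "g k x = (if f k x \<noteq> 0 then f k x else s k x)" for k x
  define close where "close q y \<longleftrightarrow> (\<forall>k\<le>N. y k \<in> cube N) \<and> (\<forall>k<N. f k (y k) * f k (y (Suc k)) \<le> 0) \<and>
      (\<forall>k\<le>N. \<forall>i. \<bar>y k i - y N i\<bar> \<le> 1 / real (Suc q))" for q and y :: "nat \<Rightarrow> nat \<Rightarrow> real"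
  have "\<exists>y. close q y" for q
  proof -
    define p where "p = 2 * int (Suc q)"
    have p: "even p" "p > 0" by (auto simp: p_def)
    define sc where "sc v = (\<lambda>i. of_int (v i) / of_int p :: real)" for v :: "nat \<Rightarrow> int"
    define \<sigma> :: "nat \<Rightarrow> (nat \<Rightarrow> int) \<Rightarrow> bit" where "\<sigma> k v = of_bool (g k (sc v) > 0)" for k v
    have sc: "sc v \<in> cube r \<longleftrightarrow> v \<in> grid p r" for v r
      using p by (auto simp: sc_def cube_def grid_def abs_divide simp flip: of_int_abs)
    have flip: "sc (flip F v) = flip F (sc v)" for F v
      by (auto simp: sc_def flip_def)
    have abs_sc: "\<bar>sc v j\<bar> = 1 \<longleftrightarrow> \<bar>v j\<bar> = p" for v j
      using p by (auto simp: sc_def abs_divide simp flip: of_int_abs)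
    have "\<exists>F \<kappa>. j \<in> F \<and> F \<subseteq> {j..r} \<and> \<kappa> r = (if j = r then 1 else 0) \<and>
        (\<forall>x\<in>grid p (Suc r). \<bar>x j\<bar> = p \<longrightarrow> (\<forall>i\<le>r. \<sigma> i (flip F x) = \<sigma> i x + \<kappa> i))"
      if r: "r < N" and j: "j \<le> r" for r j
    proof -
      obtain F c where F: "j \<in> F" "F \<subseteq> {j..r}" and c: "\<And>i. i \<le> r \<Longrightarrow> c i = 1 \<or> c i = - 1"
        and cr: "c r = (if j = r then - 1 else 1)"
        and eq: "\<And>x i. x \<in> cube (Suc r) \<Longrightarrow> \<bar>x j\<bar> = 1 \<Longrightarrow> i \<le> r \<Longrightarrow> f i (flip F x) = c i * f i x"
           "\<And>x i. x \<in> cube (Suc r) \<Longrightarrow> \<bar>x j\<bar> = 1 \<Longrightarrow> i \<le> r \<Longrightarrow> s i (flip F x) = c i * s i x"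
        using sym[OF r j] by blast
      have "\<sigma> i (flip F v) = \<sigma> i v + of_bool (c i = - 1)"
        if v: "v \<in> grid p (Suc r)" "\<bar>v j\<bar> = p" and i: "i \<le> r" for v i
      proof -
        have v': "sc v \<in> cube (Suc r)" "\<bar>sc v j\<bar> = 1" using v by (simp_all add: sc abs_sc)
        \<comment> \<open>As \<open>c i\<close> is a sign, \<open>f i\<close> vanishes at both
          points or at neither, so \<open>g\<close> takes the same branch.\<close>
        have "g i (flip F (sc v)) = c i * g i (sc v)"
          using eq[OF v' i] c[OF i] by (auto simp: g_def)
        moreover have "g i (sc v) \<noteq> 0"
          using s0[of i "sc v"] v'(1) cube_mono[of "Suc r" N] r i by (auto simp: g_def)
        ultimately show ?thesis using c[OF i] by (auto simp: \<sigma>_def flip)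
      qed
      then show ?thesis
        using F cr by (intro exI[of _ F] exI[of _ "\<lambda>i. of_bool (c i = - 1)"]) auto
    qed
    from sign_changing_chain[OF p this] obtain w where w:
      "\<And>k. k \<le> N \<Longrightarrow> w k \<in> grid p N" "\<And>k. k < N \<Longrightarrow> \<sigma> k (w k) \<noteq> \<sigma> k (w (Suc k))"
      "\<And>k i. k \<le> N \<Longrightarrow> \<bar>w k i - w N i\<bar> \<le> 1" by blast
    \<comment> \<open>If neither value of \<open>f k\<close> is zero, \<open>g\<close> agrees with
      \<open>f\<close> and unequal bits mean opposite signs; otherwise the product is zero.\<close>
    have "f k (sc (w k)) * f k (sc (w (Suc k))) \<le> 0" if "k < N" for k
      using w(2)[OF that] by (auto simp: \<sigma>_def g_def mult_le_0_iff split: if_splits)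
    moreover have "\<bar>sc (w k) i - sc (w N) i\<bar> \<le> 1 / real (Suc q)" if "k \<le> N" for k i
    proof -
      have "\<bar>sc (w k) i - sc (w N) i\<bar> = of_int \<bar>w k i - w N i\<bar> / of_int p"
        using p by (simp add: sc_def abs_divide flip: diff_divide_distrib)
      also have "\<dots> \<le> 1 / of_int p"
        using w(3)[OF that, of i] p by (intro divide_right_mono) linarith+
      also have "\<dots> \<le> 1 / real (Suc q)"
        by (intro divide_left_mono) (auto simp: p_def)
      finally show ?thesis .
    qed
    ultimately show ?thesis
      using w(1) unfolding close_def by (intro exI[of _ "\<lambda>k. sc (w k)"]) (auto simp: sc)
  qed
  then obtain y where close: "\<And>q. close q (y q)" by metis
  then have y: "\<And>q k. k \<le> N \<Longrightarrow> y q k \<in> cube N"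
    and sign: "\<And>q k. k < N \<Longrightarrow> f k (y q k) * f k (y q (Suc k)) \<le> 0"
    and dist: "\<And>q k i. k \<le> N \<Longrightarrow> \<bar>y q k i - y q N i\<bar> \<le> 1 / real (Suc q)"
    unfolding close_def by simp_all
  have "seq_compact (cube N)" using compact_cube by (rule compact_imp_seq_compact)
  moreover have "\<forall>q. y q N \<in> cube N" using y by simp
  ultimately obtain l \<phi> where l: "l \<in> cube N" "strict_mono \<phi>" "((\<lambda>q. y q N) \<circ> \<phi>) \<longlonglongrightarrow> l"
    by (rule seq_compactE)
  \<comment> \<open>All vertices of the shrinking simplices have the same limit.\<close>
  have lim: "(\<lambda>q. y (\<phi> q) k) \<longlonglongrightarrow> l" if k: "k \<le> N" for k
  proof -
    have "(\<lambda>q. y (\<phi> q) k i) \<longlonglongrightarrow> l i" for i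
    proof -
      have "(\<lambda>q. y (\<phi> q) N i) \<longlonglongrightarrow> l i"
        using l(3) continuous_on_product_coordinates[of i]
        by (auto simp: o_def intro: continuous_on_tendsto_compose[of UNIV "\<lambda>x. x i"])
      moreover have "(\<lambda>q. y (\<phi> q) k i - y (\<phi> q) N i) \<longlonglongrightarrow> 0"
      proof (rule Lim_null_comparison)
        show "\<forall>\<^sub>F q in sequentially. norm (y (\<phi> q) k i - y (\<phi> q) N i) \<le> 1 / real (Suc (\<phi> q))"
          using dist[OF k] by simp
        show "(\<lambda>q. 1 / real (Suc (\<phi> q))) \<longlonglongrightarrow> 0"
          using LIMSEQ_subseq_LIMSEQ[OF lim_1_over_n[THEN LIMSEQ_Suc] l(2)] by (simp add: o_def)
      qed
      ultimately show ?thesis using tendsto_add by fastforce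
    qed
    then have "limitin (product_topology (\<lambda>_. euclideanreal) UNIV) (\<lambda>q. y (\<phi> q) k) l sequentially"
      by (simp add: limitin_componentwise)
    then show ?thesis by (simp add: euclidean_product_topology)
  qed
  have "f k l = 0" if k: "k < N" for k
  proof -
    have "(\<lambda>q. f k (y (\<phi> q) k') ) \<longlonglongrightarrow> f k l" if "k' \<le> N" for k'
      using continuous_on_tendsto_compose[OF cont[OF k] lim[OF that] l(1)] y[OF that] by simp
    \<comment> \<open>Nonpositive products converge to a square, which is therefore zero.\<close>
    then have "(\<lambda>q. f k (y (\<phi> q) k) * f k (y (\<phi> q) (Suc k))) \<longlonglongrightarrow> f k l * f k l"
      using k by (intro tendsto_mult) auto
    then have "f k l * f k l \<le> 0"
      using sign[OF k] by (intro LIMSEQ_le_const2) auto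
    then show ?thesis by (auto simp: mult_le_0_iff)
  qed
  with l(1) show ?thesis using that by blast
qed

section \<open>Continuity of halfspace masses\<close>

lemma mass_distribution_finite_measure:
  "mass_distribution M \<Longrightarrow> finite_measure M"
  by (rule finite_measureI) (auto simp: mass_distribution_def)

lemma mass_distribution_borel_sets:
  assumes "mass_distribution M" shows "sets borel \<subseteq> sets M"
proof -
  have "sigma_sets UNIV {S. open S} \<subseteq> sets M"
    using assms sets.sigma_sets_subset[of "{S. open S}" M] by (auto simp: mass_distribution_def)
  then show ?thesis by (simp add: borel_def)
qed

lemma mass_distribution_integrable:
  fixes g :: "real ^ 'd \<Rightarrow> real"
  assumes M: "mass_distribution M" and g: "g \<in> borel_measurable borel" "\<And>z. \<bar>g z\<bar> \<le> B"
  shows "integrable M g"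
proof -
  interpret finite_measure M using M by (rule mass_distribution_finite_measure)
  have "g \<in> borel_measurable M"
    using M g(1) mass_distribution_borel_sets[OF M]
    by (auto simp: measurable_def mass_distribution_def)
  then show ?thesis
    using g(2) by (intro integrable_const_bound[of _ B]) auto
qed

text \<open>Dividing by \<open>1 + norm z\<close> makes \<open>slope a z\<close> Lipschitz in \<open>a\<close> uniformly in \<open>z\<close>, so that no
  tightness is needed in \<open>halfspace_difference_tendsto\<close>.\<close>

definition slope :: "real ^ 'd \<Rightarrow> real ^ 'd \<Rightarrow> real" where
  "slope a z = (a \<bullet> z) / (1 + norm z)"

definition clamp1 :: "real \<Rightarrow> real" where
  "clamp1 t = max (- 1) (min 1 t)"

text \<open>Equal to 1 for \<open>\<bar>t\<bar> \<le> 1\<close> and to 0 for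
  \<open>\<bar>t\<bar> \<ge> 2\<close>: a continuous majorant of the error made when
  \<open>clamp1\<close> replaces \<open>sgn\<close>.\<close>

definition bump :: "real \<Rightarrow> real" where
  "bump t = max 0 (min 1 (2 - \<bar>t\<bar>))"

lemma slope_diff_le: "\<bar>slope a z - slope b z\<bar> \<le> norm (a - b)"
proof -
  have "\<bar>slope a z - slope b z\<bar> = \<bar>(a - b) \<bullet> z\<bar> / (1 + norm z)"
    by (simp add: slope_def inner_diff_left abs_divide flip: diff_divide_distrib)
  also have "\<dots> \<le> norm (a - b) * (1 + norm z) / (1 + norm z)"
  proof (rule divide_right_mono)
    have "\<bar>(a - b) \<bullet> z\<bar> \<le> norm (a - b) * norm z" by (rule Cauchy_Schwarz_ineq2)
    also have "\<dots> \<le> norm (a - b) * (1 + norm z)" by (intro mult_left_mono) auto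
    finally show "\<bar>(a - b) \<bullet> z\<bar> \<le> norm (a - b) * (1 + norm z)" .
  qed simp
  also have "\<dots> = norm (a - b)" by (simp add: add_nonneg_eq_0_iff)
  finally show ?thesis .
qed

lemma continuous_on_slope: "continuous_on UNIV (slope a)"
  unfolding slope_def by (intro continuous_intros) (auto simp: add_nonneg_eq_0_iff)

lemma sgn_slope: "sgn (slope a z) = sgn (a \<bullet> z)"
proof -
  have "1 + norm z > 0" by (simp add: add_pos_nonneg)
  then show ?thesis by (simp add: slope_def sgn_divide)
qed

lemma clamp1_lipschitz: "\<bar>clamp1 s - clamp1 t\<bar> \<le> \<bar>s - t\<bar>"
  by (auto simp: clamp1_def)

lemma bump_lipschitz: "\<bar>bump s - bump t\<bar> \<le> \<bar>s - t\<bar>"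
  by (simp add: bump_def max_def min_def abs_if)

lemma clamp1_bound: "\<bar>clamp1 t\<bar> \<le> 1" and bump_bound: "\<bar>bump t\<bar> \<le> 1"
  by (auto simp: clamp1_def bump_def)

lemma sgn_clamp1_le_bump:
  fixes t :: real
  assumes "e > 0"
  shows "\<bar>sgn t - clamp1 (t / e)\<bar> \<le> bump (t / e)"
proof -
  have "sgn t = sgn (t / e)" using assms by (simp add: sgn_divide)
  moreover have "\<bar>sgn u - clamp1 u\<bar> \<le> bump u" for u :: real
    by (auto simp: clamp1_def bump_def sgn_if)
  ultimately show ?thesis by metis
qed

lemma continuous_on_bump_slope: "continuous_on UNIV (\<lambda>z. bump (slope a z / e))"
proof (cases "e = 0")
  case False
  then show ?thesis
    unfolding bump_def by (intro continuous_intros continuous_on_slope) auto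
qed simp

lemma continuous_on_clamp1_slope: "continuous_on UNIV (\<lambda>z. clamp1 (slope a z / e))"
proof (cases "e = 0")
  case False
  then show ?thesis
    unfolding clamp1_def by (intro continuous_intros continuous_on_slope) auto
qed simp

text \<open>By dominated convergence: the bumps shrink to the indicator of the hyperplane, which
  carries no mass.\<close>

lemma bump_slope_tendsto:
  assumes M: "mass_distribution (M :: (real ^ 'd) measure)" and a: "a \<noteq> 0"
  shows "(\<lambda>q. \<integral>z. bump (slope a z / (1 / real (Suc q))) \<partial>M) \<longlonglongrightarrow> 0"
proof -
  interpret finite_measure M using M by (rule mass_distribution_finite_measure)
  let ?H = "{z. a \<bullet> z = 0}"
  have meas: "g \<in> borel_measurable M" if "g \<in> borel_measurable borel" for g :: "real ^ 'd \<Rightarrow> real"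
    using M that mass_distribution_borel_sets[OF M] by (auto simp: measurable_def mass_distribution_def)
  have H: "?H \<in> sets borel" by (intro borel_closed closed_hyperplane)
  then have HM: "?H \<in> sets M" using mass_distribution_borel_sets[OF M] by (rule set_rev_mp)
  have "(\<lambda>q. \<integral>z. bump (slope a z / (1 / real (Suc q))) \<partial>M) \<longlonglongrightarrow> (\<integral>z. indicator ?H z \<partial>M)"
  proof (rule integral_dominated_convergence[where w = "\<lambda>_. 1"])
    show "(\<lambda>z. bump (slope a z / (1 / real (Suc q)))) \<in> borel_measurable M" for q
      by (intro meas borel_measurable_continuous_onI continuous_on_bump_slope)
    show "AE z in M. (\<lambda>q. bump (slope a z / (1 / real (Suc q)))) \<longlonglongrightarrow> indicator ?H z"
    proof (rule AE_I2)
      fix z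
      show "(\<lambda>q. bump (slope a z / (1 / real (Suc q)))) \<longlonglongrightarrow> indicator ?H z"
      proof (cases "a \<bullet> z = 0")
        case True
        then show ?thesis by (simp add: slope_def bump_def)
      next
        case False
        have "1 + norm z > 0" by (simp add: add_pos_nonneg)
        with False have pos: "\<bar>slope a z\<bar> > 0" by (simp add: slope_def)
        obtain n where n: "2 / \<bar>slope a z\<bar> < real n" using reals_Archimedean2 by blast
        have "bump (slope a z / (1 / real (Suc q))) = 0" if "q \<ge> n" for q
        proof -
          have "2 / \<bar>slope a z\<bar> \<le> real (Suc q)" using n that by linarith
          then have "2 \<le> real (Suc q) * \<bar>slope a z\<bar>" using pos by (simp add: pos_divide_le_eq)
          then have "2 \<le> \<bar>slope a z * real (Suc q)\<bar>" by (simp add: abs_mult mult.commute)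
          then show ?thesis by (simp add: bump_def)
        qed
        then have "\<forall>\<^sub>F q in sequentially. bump (slope a z / (1 / real (Suc q))) = 0"
          by (auto simp: eventually_sequentially)
        then show ?thesis using False by (simp add: tendsto_eventually)
      qed
    qed
    show "AE z in M. norm (bump (slope a z / (1 / real (Suc q)))) \<le> 1" for q
      using bump_bound by simp
    show "indicator ?H \<in> borel_measurable M"
      by (rule borel_measurable_indicator[OF HM])
    show "integrable M (\<lambda>_. 1 :: real)" by simp
  qed
  moreover have "(\<integral>z. indicator ?H z \<partial>M) = measure M ?H"
    using HM by simp
  moreover have "emeasure M ?H = 0"
    using M HM a by (auto simp: mass_distribution_def aff_dim_hyperplane)
  ultimately show ?thesis by (simp add: measure_def)
qed

text \<open>Weak convergence needs a fixed continuous test function, but \<open>sgn\<close> jumps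
  and the normal moves. So \<open>sgn\<close> is replaced by a clamped slope at the cost of a bump
  integral, and the Lipschitz bounds move the normal to \<open>a0\<close>.\<close>

lemma halfspace_difference_tendsto:
  fixes M :: "'b \<Rightarrow> (real ^ 'd) measure"
  assumes M: "\<And>x. mass_distribution (M x)" and M0: "mass_distribution M0"
    and weak: "\<And>g :: real ^ 'd \<Rightarrow> real. continuous_on UNIV g \<Longrightarrow> bounded (range g) \<Longrightarrow>
      ((\<lambda>x. integral\<^sup>L (M x) g) \<longlongrightarrow> integral\<^sup>L M0 g) F"
    and a: "(a \<longlongrightarrow> a0) F" and a0: "a0 \<noteq> 0"
  shows "((\<lambda>x. \<integral>z. sgn (a x \<bullet> z) \<partial>M x) \<longlongrightarrow> (\<integral>z. sgn (a0 \<bullet> z) \<partial>M0)) F"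
proof (rule tendstoI)
  fix \<delta> :: real assume "\<delta> > 0"
  define \<beta> where "\<beta> e b z = bump (slope b z / e)" for e :: real and b z :: "real ^ 'd"
  define \<gamma> where "\<gamma> e b z = clamp1 (slope b z / e)" for e :: real and b z :: "real ^ 'd"
  have cont: "continuous_on UNIV (\<beta> e b)" "continuous_on UNIV (\<gamma> e b)" for e b
    unfolding \<beta>_def \<gamma>_def by (rule continuous_on_bump_slope continuous_on_clamp1_slope)+
  have bound: "\<bar>\<beta> e b z\<bar> \<le> 1" "\<bar>\<gamma> e b z\<bar> \<le> 1" for e b z
    by (auto simp: \<beta>_def \<gamma>_def bump_bound clamp1_bound)
  have bounded: "bounded (range (\<beta> e b))" "bounded (range (\<gamma> e b))" for e b
    using bound by (auto intro!: boundedI[where B = 1])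
  have int: "integrable N (\<beta> e b)" "integrable N (\<gamma> e b)" "integrable N (\<lambda>z. sgn (b \<bullet> z))"
      "integrable N (\<lambda>z. 1 :: real)"
    if "mass_distribution N" "e > 0" for N e b
  proof -
    have "(\<lambda>z. sgn (b \<bullet> z)) \<in> borel_measurable borel" unfolding sgn_if by measurable
    then show "integrable N (\<lambda>z. sgn (b \<bullet> z))"
      using that by (intro mass_distribution_integrable[where B = 1]) (auto simp: sgn_if)
  qed (use that in \<open>auto intro!: mass_distribution_integrable[where B = 1]
      borel_measurable_continuous_onI cont bound\<close>)
  have near: "\<bar>(\<integral>z. sgn (b \<bullet> z) \<partial>N) - (\<integral>z. \<gamma> e b z \<partial>N)\<bar> \<le> (\<integral>z. \<beta> e b z \<partial>N)"
    if N: "mass_distribution N" and e: "e > 0" for N e b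
  proof -
    have "\<bar>(\<integral>z. sgn (b \<bullet> z) \<partial>N) - (\<integral>z. \<gamma> e b z \<partial>N)\<bar> = \<bar>\<integral>z. sgn (b \<bullet> z) - \<gamma> e b z \<partial>N\<bar>"
      using int[OF that] by simp
    also have "\<dots> \<le> (\<integral>z. \<bar>sgn (b \<bullet> z) - \<gamma> e b z\<bar> \<partial>N)" by (rule integral_abs_bound)
    also have "\<dots> \<le> (\<integral>z. \<beta> e b z \<partial>N)"
    proof (rule integral_mono)
      show "\<bar>sgn (b \<bullet> z) - \<gamma> e b z\<bar> \<le> \<beta> e b z" for z
        unfolding \<gamma>_def \<beta>_def sgn_slope[of b z, symmetric] by (rule sgn_clamp1_le_bump[OF e])
    qed (use int[OF that] in simp_all)
    finally show ?thesis .
  qed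
  have lip: "\<bar>(\<integral>z. h e b z \<partial>N) - (\<integral>z. h e c z \<partial>N)\<bar> \<le> norm (b - c) / e * (\<integral>z. 1 \<partial>N)"
    if N: "mass_distribution N" and e: "e > 0" and h: "h = \<beta> \<or> h = \<gamma>" for N e b c h
  proof -
    have ih: "integrable N (h e b)" "integrable N (h e c)" using int[OF N e] h by auto
    have "\<bar>h e b z - h e c z\<bar> \<le> norm (b - c) / e" for z
    proof -
      have "\<bar>h e b z - h e c z\<bar> \<le> \<bar>slope b z / e - slope c z / e\<bar>"
        using h bump_lipschitz clamp1_lipschitz by (auto simp: \<beta>_def \<gamma>_def)
      also have "\<dots> = \<bar>slope b z - slope c z\<bar> / e"
        using e by (simp add: abs_divide flip: diff_divide_distrib)
      also have "\<dots> \<le> norm (b - c) / e"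
        using e slope_diff_le by (intro divide_right_mono) auto
      finally show ?thesis .
    qed
    then have "(\<integral>z. \<bar>h e b z - h e c z\<bar> \<partial>N) \<le> (\<integral>z. norm (b - c) / e * 1 \<partial>N)"
      using ih int(4)[OF N e] by (intro integral_mono integrable_abs Bochner_Integration.integrable_diff
        integrable_mult_right) simp_all
    moreover have "\<bar>(\<integral>z. h e b z \<partial>N) - (\<integral>z. h e c z \<partial>N)\<bar> \<le> (\<integral>z. \<bar>h e b z - h e c z\<bar> \<partial>N)"
      using ih integral_abs_bound[of N "\<lambda>z. h e b z - h e c z"] by simp
    ultimately show ?thesis by (simp only: integral_mult_right_zero)
  qed
  have "\<forall>\<^sub>F q in sequentially. (\<integral>z. \<beta> (1 / real (Suc q)) a0 z \<partial>M0) < \<delta> / 4"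
    unfolding \<beta>_def using \<open>\<delta> > 0\<close> by (intro order_tendstoD(2)[OF bump_slope_tendsto[OF M0 a0]]) simp
  then obtain q where q: "(\<integral>z. \<beta> (1 / real (Suc q)) a0 z \<partial>M0) < \<delta> / 4"
    by (auto simp: eventually_sequentially)
  define e where "e = 1 / real (Suc q)"
  have e: "e > 0" by (simp add: e_def)
  \<comment> \<open>The error terms: the bump at \<open>M x\<close>, the moving normal in bump and
    clamp, the change of measure for the clamp, and the bump at \<open>M0\<close>.\<close>
  define R where "R x = (\<integral>z. \<beta> e a0 z \<partial>M x) + 2 * (norm (a x - a0) / e * (\<integral>z. 1 \<partial>M x))
    + \<bar>(\<integral>z. \<gamma> e a0 z \<partial>M x) - (\<integral>z. \<gamma> e a0 z \<partial>M0)\<bar> + (\<integral>z. \<beta> e a0 z \<partial>M0)" for x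
  \<comment> \<open>The total masses converge as well, the constant 1 being a test function; so the
    term with \<open>norm (a x - a0)\<close> tends to zero.\<close>
  have "(R \<longlongrightarrow> (\<integral>z. \<beta> e a0 z \<partial>M0) + 2 * (norm (a0 - a0) / e * (\<integral>z. 1 \<partial>M0))
    + \<bar>(\<integral>z. \<gamma> e a0 z \<partial>M0) - (\<integral>z. \<gamma> e a0 z \<partial>M0)\<bar> + (\<integral>z. \<beta> e a0 z \<partial>M0)) F"
    unfolding R_def using e
    by (intro tendsto_intros weak a cont bounded) auto
  then have "(R \<longlongrightarrow> 2 * (\<integral>z. \<beta> e a0 z \<partial>M0)) F" by simp
  moreover have "2 * (\<integral>z. \<beta> e a0 z \<partial>M0) < \<delta>" using q \<open>\<delta> > 0\<close> by (simp add: e_def)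
  ultimately have "\<forall>\<^sub>F x in F. R x < \<delta>" by (rule order_tendstoD)
  then show "\<forall>\<^sub>F x in F. dist (\<integral>z. sgn (a x \<bullet> z) \<partial>M x) (\<integral>z. sgn (a0 \<bullet> z) \<partial>M0) < \<delta>"
  proof eventually_elim
    case (elim x)
    show ?case
      using elim near[OF M[of x] e, of "a x"] near[OF M0 e, of a0]
        lip[OF M[of x] e disjI1[OF refl], of "a x" a0] lip[OF M[of x] e disjI2[OF refl], of "a x" a0]
      unfolding R_def dist_real_def by linarith
  qed
qed

text \<open>\<open>sgn\<close> is the difference of the indicators of the two closed half-lines,
  which cancel at 0.\<close>

lemma integral_sgn_eq:
  assumes M: "mass_distribution (M :: (real ^ 'd) measure)"
  shows "(\<integral>z. sgn (a \<bullet> z) \<partial>M) = measure M {z. a \<bullet> z \<ge> 0} - measure M {z. a \<bullet> z \<le> 0}"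
proof -
  interpret finite_measure M using M by (rule mass_distribution_finite_measure)
  have b: "{z. a \<bullet> z \<ge> 0} \<in> sets borel" "{z. a \<bullet> z \<le> 0} \<in> sets borel"
    by (auto intro!: borel_closed closed_halfspace_ge closed_halfspace_le)
  have s: "{z. a \<bullet> z \<ge> 0} \<in> sets M" "{z. a \<bullet> z \<le> 0} \<in> sets M"
    using mass_distribution_borel_sets[OF M] b by auto
  have "(\<integral>z. sgn (a \<bullet> z) \<partial>M) = (\<integral>z. indicator {z. a \<bullet> z \<ge> 0} z - indicator {z. a \<bullet> z \<le> 0} z \<partial>M)"
    by (intro Bochner_Integration.integral_cong) (auto simp: indicator_def sgn_if)
  also have "\<dots> = measure M {z. a \<bullet> z \<ge> 0} - measure M {z. a \<bullet> z \<le> 0}"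
    using s by (subst Bochner_Integration.integral_diff) (auto simp: less_top[symmetric])
  finally show ?thesis .
qed

lemma bisects_if_integral_sgn_eq_0:
  assumes M: "mass_distribution (M :: (real ^ 'd) measure)" and "a \<noteq> 0" and "(\<integral>z. sgn (a \<bullet> z) \<partial>M) = 0"
  shows "bisects {z. a \<bullet> z = 0} M"
proof -
  interpret finite_measure M using M by (rule mass_distribution_finite_measure)
  show ?thesis
    unfolding bisects_def using assms integral_sgn_eq[OF M, of a]
    by (intro exI[of _ a]) (auto simp: emeasure_eq_measure)
qed

section \<open>Hyperplanes parametrised by the cube\<close>

text \<open>Spherical coordinates on \<open>S\<^sup>m\<close>, with the sine and cosine of the \<open>i\<close>-th angle replaced by \<open>y i\<close>
  and \<open>1 - (y i)\<^sup>2\<close>; the resulting vector is nonzero but not normalised. Index \<open>0\<close> carries no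
  cosine.\<close>

definition spherical_coord :: "nat \<Rightarrow> (nat \<Rightarrow> real) \<Rightarrow> nat \<Rightarrow> real" where
  "spherical_coord m y k = (if k = 0 then 1 else 1 - (y (k - 1))\<^sup>2) * (\<Prod>i\<in>{k..<m}. y i)"

text \<open>Sine and cosine substitutes do not vanish together: either a nonzero entry survives
  multiplication by \<open>y m\<close>, or the new last entry is nonzero.\<close>

lemma spherical_coord_nonzero: "\<exists>k\<le>m. spherical_coord m y k \<noteq> 0"
proof (induction m)
  case 0
  then show ?case by (simp add: spherical_coord_def)
next
  case (Suc m)
  then obtain k where k: "k \<le> m" "spherical_coord m y k \<noteq> 0" by blast
  show ?case
  proof (cases "(y m)\<^sup>2 = 1")
    case True
    have "spherical_coord (Suc m) y k = spherical_coord m y k * y m"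
      using k(1) by (simp add: spherical_coord_def)
    moreover have "y m \<noteq> 0" using True by auto
    ultimately show ?thesis using k by (intro exI[of _ k]) auto
  next
    case False
    then show ?thesis by (intro exI[of _ "Suc m"]) (simp add: spherical_coord_def)
  qed
qed

section \<open>Effect of flips on the spherical coordinates\<close>

lemma spherical_coord_cong:
  assumes "k \<le> m" "\<And>i. i < m \<Longrightarrow> y i = z i"
  shows "spherical_coord m y k = spherical_coord m z k"
  using assms by (auto simp: spherical_coord_def intro!: arg_cong2[where f = "(*)"] prod.cong)

lemma prod_flip_singleton:
  "(\<Prod>i\<in>{k..<m}. flip {j} y i) = (if k \<le> j \<and> j < m then - 1 else 1) * (\<Prod>i\<in>{k..<m}. y i :: real)"
proof (cases "k \<le> j \<and> j < m")
  case True
  have "(\<Prod>i\<in>{k..<m}. z i) = z j * (\<Prod>i\<in>{k..<m} - {j}. z i)" for z :: "nat \<Rightarrow> real"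
    using True by (intro prod.remove) auto
  moreover have "(\<Prod>i\<in>{k..<m} - {j}. flip {j} y i) = (\<Prod>i\<in>{k..<m} - {j}. y i)"
    by (intro prod.cong) (auto simp: flip_def)
  ultimately show ?thesis using True by (simp add: flip_def)
next
  case False
  then have "(\<Prod>i\<in>{k..<m}. flip {j} y i) = (\<Prod>i\<in>{k..<m}. y i)"
    by (intro prod.cong) (auto simp: flip_def)
  with False show ?thesis by auto
qed

lemma spherical_coord_flip_singleton:
  "spherical_coord m (flip {j} y) k = (if k \<le> j \<and> j < m then - 1 else 1) * spherical_coord m y k"
proof -
  have "(flip {j} y i)\<^sup>2 = (y i)\<^sup>2" for i by (simp add: flip_def)
  then show ?thesis unfolding spherical_coord_def prod_flip_singleton by simp
qed

text \<open>Entries up to \<open>j\<close> change sign; the later ones are zero, because their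
  factor \<open>1 - (y (k - 1))\<^sup>2\<close> vanishes.\<close>

lemma spherical_coord_flip_last:
  assumes "j < m" "\<bar>y j\<bar> = 1" "\<And>i. j < i \<Longrightarrow> i < m \<Longrightarrow> y i = 1" "k \<le> m"
  shows "spherical_coord m (flip {j} y) k = - spherical_coord m y k"
proof (cases "k \<le> j")
  case True
  then show ?thesis using assms(1) by (simp add: spherical_coord_flip_singleton)
next
  case False
  then have "\<bar>y (k - 1)\<bar> = 1" using assms by (cases "k - 1 = j") auto
  then have "(y (k - 1))\<^sup>2 = 1" by (metis power2_abs one_power2)
  then have "spherical_coord m y k = 0" using False by (simp add: spherical_coord_def)
  then show ?thesis by (simp add: spherical_coord_flip_singleton)
qed

text \<open>The two flips together negate only entry \<open>Suc j\<close>, which is zero because of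
  its factor \<open>1 - (y j)\<^sup>2\<close>.\<close>

lemma spherical_coord_flip_pair:
  assumes "Suc j < m" "\<bar>y j\<bar> = 1"
  shows "spherical_coord m (flip {j, Suc j} y) k = spherical_coord m y k"
proof -
  have "flip {j, Suc j} y = flip {j} (flip {Suc j} y)" by (auto simp: flip_def)
  moreover have "spherical_coord m y (Suc j) = 0"
  proof -
    have "(y j)\<^sup>2 = 1" using assms(2) by (metis power2_abs one_power2)
    then show ?thesis by (simp add: spherical_coord_def)
  qed
  ultimately show ?thesis
    using assms(1) by (cases "k = Suc j") (auto simp: spherical_coord_flip_singleton)
qed

section \<open>Flips acting on several normal vectors\<close>

definition block :: "nat \<Rightarrow> nat \<Rightarrow> (nat \<Rightarrow> 'a) \<Rightarrow> nat \<Rightarrow> 'a" where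
  "block m b x = (\<lambda>i. x (b * m + i))"

text \<open>A pair flip stays inside one block and preserves its vector. At the end of a block, or
  at the last free coordinate \<open>r\<close>, no partner is available; the single flip then
  negates the vector, as the later coordinates of the block are absent or equal to 1.\<close>

lemma spherical_coord_block_flip:
  fixes x :: "nat \<Rightarrow> real"
  assumes "m > 0" "j \<le> r" "\<bar>x j\<bar> = 1" "\<And>i. i > r \<Longrightarrow> x i = 1" "k \<le> m"
    and ending_def: "ending \<longleftrightarrow> j = r \<or> Suc j mod m = 0"
  shows "spherical_coord m (block m b (flip (if ending then {j} else {j, Suc j}) x)) k =
    (if ending \<and> b = j div m then - 1 else 1) * spherical_coord m (block m b x) k"
proof (cases "b = j div m")
  case False
  have "block m b (flip (if ending then {j} else {j, Suc j}) x) i = block m b x i" if "i < m" for i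
  proof -
    have "(b * m + i) div m = b" using that by simp
    moreover have "Suc j div m = j div m" if "\<not> ending" using that by (auto simp: ending_def div_Suc)
    ultimately have "b * m + i \<noteq> j" "\<not> ending \<longrightarrow> b * m + i \<noteq> Suc j" using False by auto
    then show ?thesis by (auto simp: block_def flip_def)
  qed
  then have "spherical_coord m (block m b (flip (if ending then {j} else {j, Suc j}) x)) k =
      spherical_coord m (block m b x) k"
    by (rule spherical_coord_cong[OF \<open>k \<le> m\<close>])
  with False show ?thesis by simp
next
  case True
  define j' where "j' = j mod m"
  have j: "j = b * m + j'" "j' < m" using True \<open>m > 0\<close> by (simp_all add: j'_def)
  show ?thesis
  proof (cases ending)
    case True
    have "block m b (flip {j} x) = flip {j'} (block m b x)"
      using j by (auto simp: block_def flip_def)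
    moreover have "block m b x i = 1" if "j' < i" "i < m" for i
    proof -
      \<comment> \<open>A later position exists in the block, so \<open>j\<close> does not end it
        and must be \<open>r\<close>.\<close>
      have "Suc j mod m \<noteq> 0"
        using that j by (simp add: mod_Suc)
      then have "j = r" using True by (simp add: ending_def)
      then show ?thesis using that j assms(4) by (simp add: block_def)
    qed
    moreover have "\<bar>block m b x j'\<bar> = 1" using assms(3) j by (simp add: block_def)
    ultimately show ?thesis
      using True \<open>b = j div m\<close> j(2) \<open>k \<le> m\<close> by (simp add: spherical_coord_flip_last)
  next
    case False
    have "block m b (flip {j, Suc j} x) = flip {j', Suc j'} (block m b x)"
      using j by (auto simp: block_def flip_def)
    moreover have "Suc j' < m"
      using False j by (auto simp: ending_def mod_Suc split: if_splits)
    moreover have "\<bar>block m b x j'\<bar> = 1" using assms(3) j by (simp add: block_def)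
    ultimately show ?thesis using False by (simp add: spherical_coord_flip_pair)
  qed
qed

section \<open>Continuous dependence of a hyperplane on its normal vector\<close>

lemma closest_point_hyperplane:
  assumes "a \<noteq> 0"
  shows "closest_point {z. a \<bullet> z = 0} v = v - ((a \<bullet> v) / (a \<bullet> a)) *\<^sub>R (a :: 'a::euclidean_space)"
proof (rule closest_point_unique[symmetric])
  let ?p = "v - ((a \<bullet> v) / (a \<bullet> a)) *\<^sub>R a"
  show p: "?p \<in> {z. a \<bullet> z = 0}" using assms by (simp add: inner_diff_right)
  show "\<forall>z\<in>{z. a \<bullet> z = 0}. dist v ?p \<le> dist v z"
  proof
    fix z assume z: "z \<in> {z. a \<bullet> z = 0}"
    have "orthogonal (v - ?p) (?p - z)"
      using p z by (simp add: orthogonal_def inner_diff_right)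
    then have "(norm ((v - ?p) + (?p - z)))\<^sup>2 = (norm (v - ?p))\<^sup>2 + (norm (?p - z))\<^sup>2"
      by (rule norm_add_Pythagorean)
    moreover have "(v - ?p) + (?p - z) = v - z" by simp
    ultimately have "(norm (v - ?p))\<^sup>2 \<le> (norm (v - z))\<^sup>2" by (simp only:) simp
    then show "dist v ?p \<le> dist v z"
      unfolding dist_norm by (rule power2_le_imp_le) simp
  qed
qed (auto intro: convex_hyperplane closed_hyperplane)

text \<open>The topology is pulled back along the projection matrix, whose entries are rational in
  the normal vector with the nonzero denominator \<open>a x \<bullet> a x\<close>.\<close>

lemma continuous_map_hyperplane:
  fixes a :: "'b::topological_space \<Rightarrow> real ^ 'd"
  assumes cont: "continuous_on UNIV a" and a: "\<And>x. a x \<noteq> 0"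
  shows "continuous_map euclidean (grassmannian_topology (CARD('d) - 1)) (\<lambda>x. {z. a x \<bullet> z = 0})"
  unfolding grassmannian_topology_def
proof (rule continuous_map_pullback')
  have "((\<lambda>V. matrix (closest_point V)) \<circ> (\<lambda>x. {z. a x \<bullet> z = 0})) =
      (\<lambda>x. \<chi> i j. (axis j 1 - ((a x \<bullet> axis j 1) / (a x \<bullet> a x)) *\<^sub>R a x) $ i)"
    using a by (simp add: fun_eq_iff matrix_def closest_point_hyperplane)
  moreover have "continuous_on UNIV (\<lambda>x. \<chi> i j. (axis j 1 - ((a x \<bullet> axis j 1) / (a x \<bullet> a x)) *\<^sub>R a x) $ i)"
    using a by (intro continuous_intros cont) auto
  ultimately show "continuous_map euclidean euclidean
      ((\<lambda>V. matrix (closest_point V)) \<circ> (\<lambda>x. {z. a x \<bullet> z = 0}))"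
    by simp
  show "topspace euclidean \<subseteq> (\<lambda>x. {z. a x \<bullet> z = 0}) -` grassmannian (CARD('d) - 1)"
    using a by (auto simp: grassmannian_def subspace_hyperplane dim_hyperplane)
qed

section \<open>Simultaneous bisection\<close>

theorem theorem5:
  fixes n :: nat
    and \<mu> :: "nat \<Rightarrow> (nat \<Rightarrow> (real ^ 'd) set) \<Rightarrow> (real ^ 'd) measure"
  assumes "CARD('d) \<ge> 2" and "n \<ge> 1"
    and "\<And>j. j \<in> {1..(CARD('d) - 1) * n} \<Longrightarrow> mass_assignment n (\<mu> j)"
  shows "\<exists>h \<in> {1..n} \<rightarrow>\<^sub>E grassmannian (CARD('d) - 1).
           \<forall>i \<in> {1..n}. \<forall>j \<in> {(CARD('d) - 1) * (i - 1) + 1..(CARD('d) - 1) * i}.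
             bisects (h i) (\<mu> j h)"
proof -
  define m where "m = CARD('d) - 1"
  have m: "m > 0" and card_d: "CARD('d) = Suc m" using assms(1) by (simp_all add: m_def)
  obtain e :: "'d \<Rightarrow> nat" where e: "bij_betw e UNIV {0..<CARD('d)}"
    using ex_bij_betw_finite_nat[of "UNIV :: 'd set"] by auto
  have e_le: "e c \<le> m" for c
    using bij_betwE[OF e] by (simp add: card_d less_Suc_eq_le)
  define normal where "normal b x = (\<chi> c. spherical_coord m (block m b x) (e c))" for b and x :: "nat \<Rightarrow> real"
  have normal0: "normal b x \<noteq> 0" for b x
  proof -
    obtain k where k: "k \<le> m" "spherical_coord m (block m b x) k \<noteq> 0" using spherical_coord_nonzero by blast
    then have "k \<in> e ` UNIV" using e by (auto simp: bij_betw_def card_d)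
    then obtain c where "k = e c" by blast
    with k have "normal b x $ c \<noteq> 0" by (simp add: normal_def)
    then show ?thesis by auto
  qed
  have normal_cont: "continuous_on UNIV (normal b)" for b
  proof -
    have "continuous_on UNIV (\<lambda>x. spherical_coord m (block m b x) k)" for k
      unfolding spherical_coord_def block_def
      by (cases "k = 0") (auto intro!: continuous_intros)
    then show ?thesis unfolding normal_def by (intro continuous_intros)
  qed
  \<comment> \<open>Hyperplanes are numbered from 1, blocks from 0.\<close>
  define hyps where "hyps x = (\<lambda>i\<in>{1..n}. {z. normal (i - 1) x \<bullet> z = 0})" for x
  have hyps_cont: "continuous_map euclidean
      (product_topology (\<lambda>_. grassmannian_topology (CARD('d) - 1)) {1..n}) hyps"
    unfolding continuous_map_componentwise
  proof (intro conjI ballI)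
    show "hyps ` topspace euclidean \<subseteq> extensional {1..n}" by (auto simp: hyps_def)
    fix i assume "i \<in> {1..n}"
    then show "continuous_map euclidean (grassmannian_topology (CARD('d) - 1)) (\<lambda>x. hyps x i)"
      unfolding hyps_def using continuous_map_hyperplane[OF normal_cont normal0] by simp
  qed
  have mass: "mass_distribution (\<mu> (Suc k) (hyps x))"
    and weak: "continuous_on UNIV g \<Longrightarrow> bounded (range g) \<Longrightarrow>
      continuous_on UNIV (\<lambda>x. integral\<^sup>L (\<mu> (Suc k) (hyps x)) g)"
    if "k < n * m" for k x and g :: "real ^ 'd \<Rightarrow> real"
  proof -
    have "mass_assignment n (\<mu> (Suc k))"
      using that by (intro assms(3)) (auto simp: m_def mult.commute)
    then have "continuous_map euclidean weak_topology (\<mu> (Suc k) \<circ> hyps)"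
      unfolding mass_assignment_def by (rule continuous_map_compose[OF hyps_cont])
    then show "mass_distribution (\<mu> (Suc k) (hyps x))"
      "continuous_on UNIV g \<Longrightarrow> bounded (range g) \<Longrightarrow>
      continuous_on UNIV (\<lambda>x. integral\<^sup>L (\<mu> (Suc k) (hyps x)) g)"
      unfolding continuous_map_weak_topology_iff by (auto simp: o_def)
  qed
  \<comment> \<open>The difference of the two halfspace masses, by \<open>integral_sgn_eq\<close>.
    The functions are numbered from 0, the measures from 1.\<close>
  define f where "f k x = (\<integral>z. sgn (normal (k div m) x \<bullet> z) \<partial>\<mu> (Suc k) (hyps x))" for k x
  \<comment> \<open>The position chosen by \<open>SOME\<close> depends only on which entries are
    nonzero, so it is the same for a vector and its negative.\<close>
  define s where "s k x = normal (k div m) x $ (SOME c. normal (k div m) x $ c \<noteq> 0)" for k x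
  have f_cont: "continuous_on UNIV (f k)" if k: "k < n * m" for k
    unfolding continuous_on_def f_def
  proof
    fix x
    show "((\<lambda>x. \<integral>z. sgn (normal (k div m) x \<bullet> z) \<partial>\<mu> (Suc k) (hyps x)) \<longlongrightarrow>
        (\<integral>z. sgn (normal (k div m) x \<bullet> z) \<partial>\<mu> (Suc k) (hyps x))) (at x)"
      by (rule halfspace_difference_tendsto)
        (use mass[OF k] weak[OF k] normal_cont normal0 in \<open>auto simp: continuous_on_def\<close>)
  qed
  have s0: "s k x \<noteq> 0" for k x
  proof -
    have "\<exists>c. normal (k div m) x $ c \<noteq> 0" using normal0 by (metis vec_eq_iff zero_index)
    then show ?thesis unfolding s_def by (rule someI_ex)
  qed
  have sym: "\<exists>F c. j \<in> F \<and> F \<subseteq> {j..r} \<and>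
      (\<forall>i\<le>r. c i = 1 \<or> c i = - 1) \<and> c r = (if j = r then - 1 else 1) \<and>
      (\<forall>x\<in>cube (Suc r). \<bar>x j\<bar> = 1 \<longrightarrow>
        (\<forall>i\<le>r. f i (flip F x) = c i * f i x \<and> s i (flip F x) = c i * s i x))"
    if r: "r < n * m" and j: "j \<le> r" for r j
  proof -
    define ending where "ending \<longleftrightarrow> j = r \<or> Suc j mod m = 0"
    define F where "F = (if ending then {j} else {j, Suc j})"
    define c :: "nat \<Rightarrow> real" where "c i = (if ending \<and> i div m = j div m then - 1 else 1)" for i
    have "c r = (if j = r then - 1 else 1)"
    proof (cases "j < r \<and> ending")
      case True
      \<comment> \<open>Here \<open>j\<close> ends a block, so \<open>r\<close> lies in a later
        block and its function keeps its sign.\<close>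
      then have "Suc j div m = Suc (j div m)" "Suc j \<le> r" by (auto simp: ending_def div_Suc)
      then have "Suc (j div m) \<le> r div m" by (metis div_le_mono)
      with True show ?thesis by (simp add: c_def)
    qed (use j in \<open>auto simp: c_def ending_def\<close>)
    moreover have "f i (flip F x) = c i * f i x \<and> s i (flip F x) = c i * s i x"
      if x: "x \<in> cube (Suc r)" "\<bar>x j\<bar> = 1" for x i
    proof -
      have ones: "x i = 1" if "i > r" for i using x(1) that by (simp add: cube_def)
      have neg: "normal b (flip F x) = (if ending \<and> b = j div m then - 1 else 1) *\<^sub>R normal b x" for b
        using spherical_coord_block_flip[where x = x and b = b, OF m j x(2) ones e_le ending_def]
        by (simp add: vec_eq_iff normal_def F_def)
      \<comment> \<open>Opposite normals define the same hyperplane, so the measures stay the same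
        and only the integrands change sign.\<close>
      have "{z. normal b (flip F x) \<bullet> z = 0} = {z. normal b x \<bullet> z = 0}" for b
        by (simp add: neg)
      then have hyps: "hyps (flip F x) = hyps x" by (simp add: hyps_def)
      have ni: "normal (i div m) (flip F x) = c i *\<^sub>R normal (i div m) x" by (simp add: neg c_def)
      have ci: "c i = 1 \<or> c i = - 1" by (simp add: c_def)
      have "f i (flip F x) = c i * f i x"
        using ci unfolding f_def hyps ni by (auto simp: sgn_minus)
      moreover have "s i (flip F x) = c i * s i x"
        using ci unfolding s_def ni by auto
      ultimately show ?thesis by simp
    qed
    moreover have "j \<in> F" "F \<subseteq> {j..r}" using j by (auto simp: F_def ending_def)
    moreover have "\<forall>i\<le>r. c i = 1 \<or> c i = - 1" by (simp add: c_def)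
    ultimately show ?thesis by blast
  qed
  obtain x where x: "\<And>k. k < n * m \<Longrightarrow> f k x = 0"
    by (rule common_zero_of_flip_symmetric[of "n * m" f s])
      (use f_cont s0 sym in \<open>auto intro: continuous_on_subset\<close>)
  show ?thesis
  proof (intro bexI ballI)
    show "hyps x \<in> {1..n} \<rightarrow>\<^sub>E grassmannian (CARD('d) - 1)"
      using continuous_map_image_subset_topspace[OF hyps_cont] by auto
    fix i j assume i: "i \<in> {1..n}" and j: "j \<in> {(CARD('d) - 1) * (i - 1) + 1..(CARD('d) - 1) * i}"
    obtain i' where i': "i = Suc i'" using i by (cases i) auto
    obtain k where k: "j = Suc k" using j by (cases j) auto
    have b: "m * i' \<le> k" "k < m * Suc i'" using j unfolding i' k m_def[symmetric] by auto
    have km: "k div m = i'" using b by (intro div_nat_eqI) (auto simp: mult.commute)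
    have kn: "k < n * m"
    proof -
      have "m * Suc i' \<le> m * n" using i i' by (intro mult_le_mono2) auto
      with b show ?thesis by (simp add: mult.commute)
    qed
    have "bisects {z. normal i' x \<bullet> z = 0} (\<mu> j (hyps x))"
      using bisects_if_integral_sgn_eq_0[OF mass[OF kn] normal0[of i' x]] x[OF kn] by (simp add: f_def km k)
    then show "bisects (hyps x i) (\<mu> j (hyps x))" using i i' by (simp add: hyps_def)
  qed
qed

end
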